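(* Consider a sequence of one-period robust binomial models with parameters $u^n,U^n,d^n,D^n,\pi^n,\Pi^n$ satisfying (A1)–(A4) as listed in the context, with limits $d,D,u,U$. Let $U=+\infty$. Then the following properties are equivalent: (i) NAA1$(\mathcal{P}^n)$; (ii) $\limsup\Pi^n=0$, $d<1$ and $D<+\infty$; (iii) for each sequence $(P^n)_{n\ge1}$ with $P^n\in\mathcal{P}^n$ for all $n$, there exists a sequence $(Q^n)_{n\ge1}$ with $Q^n\in\mathcal{Q}^n$ for all $n$ such that $(P^n)_{n\ge1}\triangleleft(Q^n)_{n\ge1}$.
   Context: Assumptions on the real parameters $u^n,U^n,d^n,D^n,\pi^n,\Pi^n$, for all $n\in\mathbb{N}$: (A1) $0<\pi^n\le\Pi^n<1$; $d^n\le D^n$ and $u^n\le U^n$; $0<d^n<1<U^n$. (A2) $d^n<\min(u^n,D^n)$ and $\max(u^n,D^n)<U^n$. (A3) There exist $d\in[0,1]$, $D\in[0,+\infty]$, $u\in[0,+\infty]$, $U\in[1,+\infty]$ with $d^n\to d$, $D^n\to D$, $u^n\to u$, $U^n\to U$. (A4) $d<U$; $[d,D]\ne\{1\}$ or $\limsup\Pi^n>0$; $[u,U]\ne\{1\}$ or $\liminf\pi^n<1$. Model: $\Omega^n=\Omega=(0,+\infty)$ with Borel $\sigma$-algebra $\mathcal{F}$; $S^n_0=1$, $S^n_1=Y^n_1$, where $Y^n_1:(0,+\infty)\to(0,+\infty)$ is a bijective measurable map. Let $I^n=[u^n,U^n]\times[d^n,D^n]\times[\pi^n,\Pi^n]$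 and $\mathcal{L}^n_1=\{p\,\delta_{x}+(1-p)\,\delta_{y}:(x,y,p)\in I^n\}$. $\mathcal{R}^n$ is the set of probability measures $R$ on $(\Omega,\mathcal{F})$ whose law $R\circ(Y^n_1)^{-1}$ belongs to $\mathcal{L}^n_1$. $\mathcal{P}^n=\{\sum_{k=1}^\infty\alpha_kR_k:R_k\in\mathcal{R}^n,\ 0\le\alpha_k\le1,\ \sum_k\alpha_k=1\}$. Extended $\sigma$-algebra: for $R\in\mathcal{R}^n$ write $R\circ(Y^n_1)^{-1}=\pi_R\delta_{u_R}+(1-\pi_R)\delta_{d_R}$ with $(u_R,d_R,\pi_R)\in I^n$, and $S_R=\{Y^n_1=d_R\}\cup\{Y^n_1=u_R\}$. Fix $\widetilde{\mathcal{R}}^n\subseteq\mathcal{R}^n$ such that the sets $S_R$, $R\in\widetilde{\mathcal{R}}^n$, are pairwise disjoint and such that $\widetilde{\mathcal{R}}^n$ and $\mathcal{R}^n$ have the same null sets in $\mathcal{F}$ (a set $A\in\mathcal F$ is null for all measures of one family iff it is for the other). Put $\widetilde{\mathcal{F}}^n=\sigma\bigl(\mathcal{F}\cup\{\bigcup_{R\in\widetilde{\mathcal{R}}^n}E_R:E_R\subseteq S_R,\ E_R\in\mathcal{F}\}\bigr)$. Each $P\in\mathcal{P}^n$ is extended to $\widetilde{\mathcal{F}}^n$ by $P(A)=\sum_kP(A\cap S_{R_k})$, where $(R_k)$ are the (at most countably many) elements of $\widetilde{\mathcal{R}}^n$ with $P(S_{R_k})\ne0$. From now on the $n$-th market is $(\Omega,\widetilde{\mathcal{F}}^n)$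 with $\mathcal{P}^n$ denoting the set of extended measures. $\mathcal{P}^n$-q.s. means outside a set contained in a set of $\widetilde{\mathcal{F}}^n$ that is $P$-null for all $P\in\mathcal{P}^n$. $\mathcal{Q}^n$ is the set of probability measures $Q$ on $(\Omega,\widetilde{\mathcal{F}}^n)$ with $Q\ll P$ for some $P\in\mathcal{P}^n$ and $E_Q[S^n_1-S^n_0]=0$ (with convention $E_Q[f]=E_Q[f^+]-E_Q[f^-]$, $\infty-\infty=-\infty$). AA1$(\mathcal{P}^n)$: there exist a subsequence $n_k$, $H^{n_k}\in\mathbb{R}$, and positive reals $c_k\to0$ such that $X^k_1=H^{n_k}(S^{n_k}_1-S^{n_k}_0)$ satisfies (i) $X^k_1\ge-c_k$ $\mathcal{P}^{n_k}$-q.s. for all $k$, and (ii) there exist $\alpha>0$ and $P^k\in\mathcal{P}^{n_k}$ with $P^k(X^k_1\ge\alpha)\ge\alpha$ for all $k$. NAA1$(\mathcal{P}^n)$ means no AA1$(\mathcal{P}^n)$ exists. Contiguity: $(P^n)\triangleleft(Q^n)$ means that $Q^n(A^n)\to0$ with $A^n\in\widetilde{\mathcal{F}}^n$ implies $P^n(A^n)\to0$. *)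

theory Defs
  imports "HOL-Probability.Probability"
begin

section \<open>A one-period robust binomial market\<close>

definition base_space :: "real measure" where
  "base_space = restrict_space borel {0<..}"

definition two_point_law :: "real \<Rightarrow> real \<Rightarrow> real \<Rightarrow> real measure" where
  "two_point_law x y p = measure_of (space base_space) (sets base_space)
     (\<lambda>A. ennreal p * emeasure (return base_space x) A
        + ennreal (1 - p) * emeasure (return base_space y) A)"

text \<open>Below, \<open>I\<close> is the set of admissible triples (up value, down value, probability of the
  up value) and \<open>Y\<close> is the stock price at time 1. Only the values of \<open>Y\<close> on
  \<open>(0, \<infinity>)\<close> matter.\<close>

definition elementary_priors :: "(real \<times> real \<times> real) set \<Rightarrow> (real \<Rightarrow> real) \<Rightarrow> real measure set" where
  "elementary_priors I Y = {R. prob_space R \<and> sets R = sets base_space \<and>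
     distr R base_space Y \<in> {two_point_law x y p | x y p. (x, y, p) \<in> I}}"

definition countable_mixture :: "(nat \<Rightarrow> real) \<Rightarrow> (nat \<Rightarrow> real measure) \<Rightarrow> real measure" where
  "countable_mixture \<alpha> R = measure_of (space base_space) (sets base_space)
     (\<lambda>A. \<Sum>k. ennreal (\<alpha> k) * emeasure (R k) A)"

definition priors :: "(real \<times> real \<times> real) set \<Rightarrow> (real \<Rightarrow> real) \<Rightarrow> real measure set" where
  "priors I Y = {countable_mixture \<alpha> R | \<alpha> R.
     (\<forall>k. R k \<in> elementary_priors I Y \<and> 0 \<le> \<alpha> k \<and> \<alpha> k \<le> 1) \<and> \<alpha> sums 1}"

text \<open>The triple representing the law of \<open>Y\<close> under \<open>R\<close> need not be unique when the
  ranges of the up and down values overlap. If all probabilities lie in \<open>(0, 1)\<close>, every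
  choice has the same set of values \<open>{u\<^sub>R, d\<^sub>R}\<close>, so that \<open>carrier_set\<close> below does not
  depend on it.\<close>

definition law_params ::
  "(real \<times> real \<times> real) set \<Rightarrow> (real \<Rightarrow> real) \<Rightarrow> real measure \<Rightarrow> real \<times> real \<times> real" where
  "law_params I Y R =
     (SOME t. t \<in> I \<and> distr R base_space Y = (case t of (x, y, p) \<Rightarrow> two_point_law x y p))"

definition carrier_set ::
  "(real \<times> real \<times> real) set \<Rightarrow> (real \<Rightarrow> real) \<Rightarrow> real measure \<Rightarrow> real set" where
  "carrier_set I Y R = (case law_params I Y R of (u\<^sub>R, d\<^sub>R, p\<^sub>R) \<Rightarrow>
     {\<omega> \<in> space base_space. Y \<omega> = d\<^sub>R} \<union> {\<omega> \<in> space base_space. Y \<omega> = u\<^sub>R})"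

definition disjoint_reduction ::
  "(real \<times> real \<times> real) set \<Rightarrow> (real \<Rightarrow> real) \<Rightarrow> real measure set \<Rightarrow> bool" where
  "disjoint_reduction I Y Rt \<longleftrightarrow>
     Rt \<subseteq> elementary_priors I Y \<and>
     disjoint_family_on (carrier_set I Y) Rt \<and>
     (\<forall>A \<in> sets base_space.
        (\<forall>R\<in>Rt. emeasure R A = 0) \<longleftrightarrow> (\<forall>R\<in>elementary_priors I Y. emeasure R A = 0))"

text \<open>Only the underlying measurable space of \<open>ext_space\<close> is relevant; as a measure it is
  zero.\<close>

definition ext_space ::
  "(real \<times> real \<times> real) set \<Rightarrow> (real \<Rightarrow> real) \<Rightarrow> real measure set \<Rightarrow> real measure" where
  "ext_space I Y Rt = sigma (space base_space)
     (sets base_space \<union>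
      {\<Union>R\<in>Rt. E R | E. \<forall>R\<in>Rt. E R \<subseteq> carrier_set I Y R \<and> E R \<in> sets base_space})"

text \<open>The integral against the counting measure is the sum of \<open>P (A \<inter> S\<^sub>R)\<close> over the
  (countably many) \<open>R\<close> with \<open>P (S\<^sub>R) \<noteq> 0\<close>.\<close>

definition ext_measure ::
  "(real \<times> real \<times> real) set \<Rightarrow> (real \<Rightarrow> real) \<Rightarrow> real measure set \<Rightarrow> real measure \<Rightarrow> real measure"
  where
  "ext_measure I Y Rt P = measure_of (space base_space) (sets (ext_space I Y Rt))
     (\<lambda>A. \<integral>\<^sup>+ R. emeasure P (A \<inter> carrier_set I Y R)
            \<partial>count_space {R\<in>Rt. emeasure P (carrier_set I Y R) \<noteq> 0})"

definition ext_priors ::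
  "(real \<times> real \<times> real) set \<Rightarrow> (real \<Rightarrow> real) \<Rightarrow> real measure set \<Rightarrow> real measure set" where
  "ext_priors I Y Rt = ext_measure I Y Rt ` priors I Y"

definition S0 :: "real \<Rightarrow> real" where
  "S0 \<omega> = 1"

text \<open>The subtraction convention \<open>\<infinity> - \<infinity> = -\<infinity>\<close> differs from the one
  for \<^typ>\<open>ereal\<close>.\<close>

definition ext_expectation :: "'a measure \<Rightarrow> ('a \<Rightarrow> real) \<Rightarrow> ereal" where
  "ext_expectation Q f =
     (let a = \<integral>\<^sup>+ \<omega>. ennreal (max 0 (f \<omega>)) \<partial>Q; b = \<integral>\<^sup>+ \<omega>. ennreal (max 0 (- f \<omega>)) \<partial>Q
      in if a = \<infinity> \<and> b = \<infinity> then - \<infinity> else enn2ereal a - enn2ereal b)"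

definition martingale_measures ::
  "(real \<times> real \<times> real) set \<Rightarrow> (real \<Rightarrow> real) \<Rightarrow> real measure set \<Rightarrow> real measure set" where
  "martingale_measures I Y Rt = {Q. prob_space Q \<and> sets Q = sets (ext_space I Y Rt) \<and>
     (\<exists>P\<in>ext_priors I Y Rt. absolutely_continuous P Q) \<and>
     ext_expectation Q (\<lambda>\<omega>. Y \<omega> - S0 \<omega>) = 0}"

section \<open>Sequences of markets\<close>

definition quasi_surely :: "'a measure \<Rightarrow> 'a measure set \<Rightarrow> ('a \<Rightarrow> bool) \<Rightarrow> bool" where
  "quasi_surely G \<P> \<phi> \<longleftrightarrow>
     (\<exists>N\<in>sets G. (\<forall>P\<in>\<P>. emeasure P N = 0) \<and> {\<omega>\<in>space G. \<not> \<phi> \<omega>} \<subseteq> N)"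

text \<open>\<open>G n\<close> carries the \<open>\<sigma>\<close>-algebra of the \<open>n\<close>-th market, \<open>\<P> n\<close> its priors, and
  \<open>\<Delta> n\<close> is the increment of its price process.\<close>

definition AA1 ::
  "(nat \<Rightarrow> 'a measure) \<Rightarrow> (nat \<Rightarrow> 'a measure set) \<Rightarrow> (nat \<Rightarrow> 'a \<Rightarrow> real) \<Rightarrow> bool" where
  "AA1 G \<P> \<Delta> \<longleftrightarrow>
     (\<exists>(r :: nat \<Rightarrow> nat) (H :: nat \<Rightarrow> real) (c :: nat \<Rightarrow> real).
        strict_mono r \<and> (\<forall>k. 0 < c k) \<and> c \<longlonglongrightarrow> 0 \<and>
        (\<forall>k. quasi_surely (G (r k)) (\<P> (r k)) (\<lambda>\<omega>. H (r k) * \<Delta> (r k) \<omega> \<ge> - c k)) \<and>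
        (\<exists>\<alpha>>0. \<exists>P. \<forall>k. P k \<in> \<P> (r k) \<and>
           measure (P k) {\<omega>\<in>space (G (r k)). H (r k) * \<Delta> (r k) \<omega> \<ge> \<alpha>} \<ge> \<alpha>))"

definition NAA1 ::
  "(nat \<Rightarrow> 'a measure) \<Rightarrow> (nat \<Rightarrow> 'a measure set) \<Rightarrow> (nat \<Rightarrow> 'a \<Rightarrow> real) \<Rightarrow> bool" where
  "NAA1 G \<P> \<Delta> \<longleftrightarrow> \<not> AA1 G \<P> \<Delta>"

text \<open>\<open>P\<close> is contiguous with respect to \<open>Q\<close>.\<close>

definition contiguous ::
  "(nat \<Rightarrow> 'a measure) \<Rightarrow> (nat \<Rightarrow> 'a measure) \<Rightarrow> (nat \<Rightarrow> 'a measure) \<Rightarrow> bool" where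
  "contiguous G P Q \<longleftrightarrow>
     (\<forall>A. (\<forall>n. A n \<in> sets (G n)) \<longrightarrow> (\<lambda>n. measure (Q n) (A n)) \<longlonglongrightarrow> 0 \<longrightarrow>
          (\<lambda>n. measure (P n) (A n)) \<longlonglongrightarrow> 0)"

end

theory Submission
  imports Defs
begin

text \<open>Since \<open>Y\<close> is a bijection, every prior is the image, under the inverse of \<open>Y\<close>, of a discrete
  law on prices, namely a countable mixture of two-point laws; the extension to the larger
  \<open>\<sigma>\<close>-algebra keeps the same atoms. All arguments therefore take place on discrete price laws.

  If (ii) fails, buying stock is an asymptotic arbitrage: \<open>1 / sqrt U\<close> units
  if the probabilities of the up move do not vanish, \<open>1 / sqrt D\<close> units if \<open>D\<close> tends to infinity,
  and one unit if \<open>d\<close> tends to 1. If (ii) holds, one replaces each two-point law in the mixture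
  \<open>P\<close> by its down value, which changes the probability of an event by at most \<open>\<Pi>\<close>, and mixes the
  result with a law on \<open>{U, d}\<close> to get a martingale measure; the weight of the first component can
  be chosen bounded away from 0. Finally (iii) excludes arbitrage by Markov's inequality under
  the martingale measures.\<close>

section \<open>Discrete two-point laws\<close>

text \<open>The laws, mixtures and extensions of the model are all given by set functions passed to
  \<open>measure_of\<close>. Recognising the set function as that of a known measure avoids proving
  countable additivity each time.\<close>

lemma measure_of_emeasure_eqI:
  assumes "sets M = sets N" "\<And>A. A \<in> sets M \<Longrightarrow> f A = emeasure M A"
  shows "measure_of (space M) (sets N) f = M"
proof -
  have "measure_of (space M) (sets M) f = measure_of (space M) (sets M) (emeasure M)"
    by (rule measure_of_eq) (auto simp: sets.space_closed sets.sigma_sets_eq assms(2))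
  then show ?thesis
    by (simp add: assms(1)[symmetric] measure_of_of_measure)
qed

lemma space_base_space: "space base_space = {0<..}"
  by (simp add: base_space_def space_restrict_space)

lemma base_space_finite_sets: "finite A \<Longrightarrow> A \<subseteq> {0<..} \<Longrightarrow> A \<in> sets base_space"
  by (auto simp: base_space_def sets_restrict_space_iff intro: finite_imp_closed borel_closed)

lemma id_measurable_base_space: "(\<lambda>x. x) \<in> measurable base_space borel"
  unfolding base_space_def by (rule measurable_restrict_space1) simp

text \<open>A pmf makes every set of prices measurable, and supports and mixtures become
  \<open>set_pmf\<close> and \<open>bind_pmf\<close>.\<close>

definition two_point :: "real \<times> real \<times> real \<Rightarrow> real pmf" where
  "two_point t = (case t of (x, y, p) \<Rightarrow> map_pmf (\<lambda>b. if b then x else y) (bernoulli_pmf p))"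

lemma emeasure_two_point:
  assumes "0 \<le> p" "p \<le> 1"
  shows "emeasure (measure_pmf (two_point (x, y, p))) A
    = ennreal p * indicator A x + ennreal (1 - p) * indicator A y"
  using assms
  by (subst nn_integral_indicator[symmetric])
     (auto simp: two_point_def indicator_def mult.commute)

lemma set_two_point:
  assumes "0 < p" "p < 1"
  shows "set_pmf (two_point (x, y, p)) = {x, y}"
  using assms by (auto simp: two_point_def set_pmf_bernoulli)

lemma sets_two_point_law: "sets (two_point_law x y p) = sets base_space"
  by (simp add: two_point_law_def sets.space_closed sets.sigma_sets_eq)

lemma emeasure_two_point_law:
  assumes "0 < x" "0 < y" "0 \<le> p" "p \<le> 1" and A: "A \<in> sets base_space"
  shows "emeasure (two_point_law x y p) A = emeasure (measure_pmf (two_point (x, y, p))) A"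
proof -
  \<comment> \<open>The map must land in the positive reals. The default 1 is harmless, since the
    law charges only the positive values \<open>x\<close> and \<open>y\<close>.\<close>
  let ?M = "distr (measure_pmf (two_point (x, y, p))) base_space (\<lambda>v. if 0 < v then v else 1)"
  have emM: "emeasure ?M B = emeasure (measure_pmf (two_point (x, y, p))) B"
    if "B \<in> sets base_space" for B
  proof -
    have "emeasure ?M B = emeasure (measure_pmf (two_point (x, y, p)))
       ((\<lambda>v. if 0 < v then v else 1) -` B)"
      using that by (subst emeasure_distr) (auto simp: space_base_space)
    also have "\<dots> = emeasure (measure_pmf (two_point (x, y, p))) B"
      using assms by (simp add: emeasure_two_point indicator_def)
    finally show ?thesis .
  qed
  have "two_point_law x y p = ?M"
    unfolding two_point_law_def
    using measure_of_emeasure_eqI[of ?M base_space "\<lambda>A. ennreal p * emeasure (return base_space x) A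
        + ennreal (1 - p) * emeasure (return base_space y) A"]
    using assms by (simp add: emM emeasure_two_point)
  then show ?thesis
    using emM[OF A] by simp
qed

section \<open>Priors as laws of the price\<close>

text \<open>One market of the sequence. The strict bounds on \<open>p\<close> make both prices of a
  triple atoms of its law.\<close>

locale binomial_market =
  fixes I :: "(real \<times> real \<times> real) set" and Y :: "real \<Rightarrow> real" and Rt :: "real measure set"
  assumes params_pos: "\<And>x y p. (x, y, p) \<in> I \<Longrightarrow> 0 < x \<and> 0 < y \<and> 0 < p \<and> p < 1"
    and Y_measurable: "Y \<in> measurable base_space base_space"
    and Y_bij: "bij_betw Y {0<..} {0<..}"
    and reduction: "disjoint_reduction I Y Rt"
begin

text \<open>The inverse of \<open>Y\<close>, with an arbitrary positive value off its domain so that it is a map into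
  the sample space.\<close>

definition state :: "real \<Rightarrow> real" where
  "state x = (if 0 < x then inv_into {0<..} Y x else 1)"

lemma state_pos: "0 < state x"
  using Y_bij inv_into_into[of x Y "{0<..}"] by (auto simp: state_def bij_betw_def)

lemma Y_state: "0 < x \<Longrightarrow> Y (state x) = x"
  using Y_bij f_inv_into_f[of x Y "{0<..}"] by (auto simp: state_def bij_betw_def)

lemma Y_pos: "0 < \<omega> \<Longrightarrow> 0 < Y \<omega>"
  using Y_bij by (auto simp: bij_betw_def)

lemma state_Y: "0 < \<omega> \<Longrightarrow> state (Y \<omega>) = \<omega>"
  using Y_bij Y_pos by (auto simp: state_def bij_betw_def)

text \<open>Every map is measurable on a pmf, so only the range of \<open>state\<close> matters. The
  same map can therefore push price laws to the base and to the extended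
  \<open>\<sigma>\<close>-algebra.\<close>

lemma state_measurable: "space N = {0<..} \<Longrightarrow> state \<in> measurable (measure_pmf q) N"
  by (simp add: state_pos)

lemma emeasure_distr_state:
  "space N = {0<..} \<Longrightarrow> A \<in> sets N \<Longrightarrow>
    emeasure (distr (measure_pmf q) N state) A = emeasure (measure_pmf q) (state -` A)"
  using state_measurable[of N q] by (simp add: emeasure_distr)

lemma distr_Y_eq_two_point_law:
  assumes t: "(x, y, p) \<in> I"
  shows "distr (distr (measure_pmf (two_point (x, y, p))) base_space state) base_space Y
    = two_point_law x y p"
proof (rule measure_eqI)
  note pos = params_pos[OF t]
  fix A assume "A \<in> sets (distr (distr (measure_pmf (two_point (x, y, p))) base_space state) base_space Y)"
  then have A: "A \<in> sets base_space" by simp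
  have "emeasure (distr (distr (measure_pmf (two_point (x, y, p))) base_space state) base_space Y) A
    = emeasure (measure_pmf (two_point (x, y, p))) (state -` (Y -` A \<inter> {0<..}))"
    using A Y_measurable measurable_sets[OF Y_measurable A]
    by (simp add: emeasure_distr emeasure_distr_state space_base_space)
  also have "\<dots> = emeasure (two_point_law x y p) A"
    using pos A by (simp add: emeasure_two_point_law emeasure_two_point indicator_def Y_state state_pos)
  finally show "emeasure (distr (distr (measure_pmf (two_point (x, y, p))) base_space state) base_space Y) A
    = emeasure (two_point_law x y p) A" .
qed (simp add: sets_two_point_law)

text \<open>The law of \<open>Y\<close> shows that \<open>R\<close> has mass 1 on the two states
  \<open>state x\<close> and \<open>state y\<close>. Hence \<open>R\<close> is determined by its
  values on finite sets of states, and these are read off from the law of \<open>Y\<close>.\<close>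

lemma prior_eqI:
  assumes R: "prob_space R" "sets R = sets base_space" and t: "(x, y, p) \<in> I"
    and law: "distr R base_space Y = two_point_law x y p"
  shows "R = distr (measure_pmf (two_point (x, y, p))) base_space state"
proof (rule measure_eqI)
  interpret R: prob_space R by fact
  note pos = params_pos[OF t]
  have spR: "space R = {0<..}"
    using sets_eq_imp_space_eq[OF R(2)] by (simp add: space_base_space)
  have YR: "Y \<in> measurable R base_space"
    using Y_measurable by (simp cong: measurable_cong_sets add: R(2))
  \<comment> \<open>On finite sets of prices, the image under \<open>state\<close> is measurable and
    equals a preimage under \<open>Y\<close>.\<close>
  have em: "emeasure R (state ` B) = emeasure (measure_pmf (two_point (x, y, p))) B"
    if "finite B" "B \<subseteq> {0<..}" for B
  proof -
    have "state ` B = Y -` B \<inter> {0<..}"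
      using that by (auto simp: Y_state state_pos state_Y intro!: rev_image_eqI)
    then have "emeasure R (state ` B) = emeasure (distr R base_space Y) B"
      using that by (simp add: emeasure_distr YR base_space_finite_sets spR)
    also have "\<dots> = emeasure (measure_pmf (two_point (x, y, p))) B"
      using that pos by (simp add: law emeasure_two_point_law base_space_finite_sets)
    finally show ?thesis .
  qed
  have "emeasure R {state x, state y} = 1"
    using em[of "{x, y}"] pos by (simp add: emeasure_two_point flip: ennreal_plus)
  moreover have "{state x, state y} \<in> sets R"
    by (auto simp: R(2) state_pos intro!: base_space_finite_sets)
  ultimately have AE: "AE \<omega> in R. \<omega> \<in> {state x, state y}"
    by (intro R.AE_prob_1) (simp add: measure_def)
  fix A assume "A \<in> sets R"
  then have A: "A \<in> sets R" "A \<in> sets base_space" by (simp_all add: R(2))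
  have fin: "A \<inter> {state x, state y} \<in> sets R"
    by (auto simp: R(2) state_pos intro!: base_space_finite_sets)
  have "emeasure R A = emeasure R (A \<inter> {state x, state y})"
    using AE A fin by (intro emeasure_eq_AE) (auto elim: eventually_mono)
  also have "A \<inter> {state x, state y} = state ` ({x, y} \<inter> state -` A)"
    by auto
  also have "emeasure R \<dots> = emeasure (measure_pmf (two_point (x, y, p))) ({x, y} \<inter> state -` A)"
    using pos by (intro em) auto
  also have "\<dots> = emeasure (measure_pmf (two_point (x, y, p))) (state -` A)"
    using pos by (simp add: emeasure_two_point indicator_def)
  finally show "emeasure R A = emeasure (distr (measure_pmf (two_point (x, y, p))) base_space state) A"
    using A by (simp add: emeasure_distr_state space_base_space)
qed (simp add: R)

lemma elementary_priors_eq: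
  "elementary_priors I Y = (\<lambda>t. distr (measure_pmf (two_point t)) base_space state) ` I"
proof (intro equalityI subsetI)
  fix R assume "R \<in> elementary_priors I Y"
  then obtain x y p where "prob_space R" "sets R = sets base_space" "(x, y, p) \<in> I"
    "distr R base_space Y = two_point_law x y p"
    by (auto simp: elementary_priors_def)
  then show "R \<in> (\<lambda>t. distr (measure_pmf (two_point t)) base_space state) ` I"
    using prior_eqI by blast
next
  fix R assume "R \<in> (\<lambda>t. distr (measure_pmf (two_point t)) base_space state) ` I"
  then show "R \<in> elementary_priors I Y"
    by (force simp: elementary_priors_def distr_Y_eq_two_point_law space_base_space state_pos
        intro!: measure_pmf.prob_space_distr)
qed

end

section \<open>Countable mixtures as random choices of a triple\<close>

text \<open>Together with \<open>nat_pmf_of_sums\<close>, this identifies the weight sequences of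
  mixtures with the pmfs on the naturals.\<close>

lemma pmf_nat_sums: "pmf (a :: nat pmf) sums 1"
proof -
  have eq: "(\<Sum>k. ennreal (pmf a k)) = 1"
    using nn_integral_pmf[where p = a and A = UNIV] by (simp add: nn_integral_count_space_nat)
  then have "summable (pmf a)"
    by (intro summable_suminf_not_top) auto
  moreover have "suminf (pmf a) = 1"
    using eq suminf_ennreal2[of "pmf a"] \<open>summable (pmf a)\<close>
    by (metis ennreal_eq_1 pmf_nonneg)
  ultimately show ?thesis
    by (metis summable_sums)
qed

lemma nat_pmf_of_sums:
  fixes \<alpha> :: "nat \<Rightarrow> real"
  assumes "\<And>k. 0 \<le> \<alpha> k" "\<alpha> sums 1"
  obtains a where "pmf a = \<alpha>"
proof
  show "pmf (embed_pmf \<alpha>) = \<alpha>"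
    using assms by (intro ext pmf_embed_pmf)
      (simp_all add: nn_integral_count_space_nat suminf_ennreal_eq sums_unique[symmetric])
qed

text \<open>The weights become the law \<open>a\<close> of a random index, so that mixing is a bind
  of pmfs.\<close>

definition mixture :: "nat pmf \<Rightarrow> (nat \<Rightarrow> real \<times> real \<times> real) \<Rightarrow> real pmf" where
  "mixture a t = bind_pmf a (\<lambda>k. two_point (t k))"

lemma sets_base_subset_ext: "A \<in> sets base_space \<Longrightarrow> A \<in> sets (ext_space I Y S)"
  and space_ext_space: "space (ext_space I Y S) = {0<..}"
proof -
  have "carrier_set I Y R \<subseteq> space base_space" for R
    by (auto simp: carrier_set_def split: prod.splits)
  then have *: "sets base_space \<union>
      {\<Union>R\<in>S. E R | E. \<forall>R\<in>S. E R \<subseteq> carrier_set I Y R \<and> E R \<in> sets base_space} \<subseteq> Pow (space base_space)"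
    using sets.sets_into_space by blast
  show "A \<in> sets base_space \<Longrightarrow> A \<in> sets (ext_space I Y S)"
    using * by (simp add: ext_space_def)
  show "space (ext_space I Y S) = {0<..}"
    using * by (simp add: ext_space_def space_base_space)
qed

context binomial_market
begin

text \<open>The mass of a set under a bind is the series of component masses weighted by
  \<open>pmf a k\<close>, and taking images under \<open>state\<close> commutes with it.\<close>

lemma countable_mixture_eq:
  assumes "pmf a = \<alpha>"
  shows "countable_mixture \<alpha> (\<lambda>k. distr (measure_pmf (two_point (t k))) base_space state)
    = distr (measure_pmf (mixture a t)) base_space state"
  using measure_of_emeasure_eqI[of "distr (measure_pmf (mixture a t)) base_space state" base_space
      "\<lambda>A. \<Sum>k. ennreal (\<alpha> k) *
        emeasure (distr (measure_pmf (two_point (t k))) base_space state) A"]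
  by (simp add: countable_mixture_def emeasure_distr_state space_base_space mixture_def
      nn_integral_measure_pmf nn_integral_count_space_nat assms)

lemma priors_eq:
  "priors I Y = {distr (measure_pmf (mixture a t)) base_space state | a t. \<forall>k. t k \<in> I}"
proof (intro equalityI subsetI)
  fix P assume "P \<in> priors I Y"
  then obtain \<alpha> R where *: "P = countable_mixture \<alpha> R \<and>
      (\<forall>k. R k \<in> elementary_priors I Y \<and> 0 \<le> \<alpha> k \<and> \<alpha> k \<le> 1) \<and> \<alpha> sums 1"
    unfolding priors_def mem_Collect_eq by (elim exE)
  then have R: "\<And>k. R k \<in> elementary_priors I Y" and "\<And>k. 0 \<le> \<alpha> k" "\<alpha> sums 1"
    and P: "P = countable_mixture \<alpha> R"
    by auto
  then obtain a where a: "pmf a = \<alpha>"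
    by (metis nat_pmf_of_sums)
  from R have "\<exists>t. \<forall>k. t k \<in> I \<and> R k = distr (measure_pmf (two_point (t k))) base_space state"
    by (intro choice) (simp add: elementary_priors_eq image_iff Bex_def)
  then obtain t where t: "\<And>k. t k \<in> I"
    and "R = (\<lambda>k. distr (measure_pmf (two_point (t k))) base_space state)"
    by auto
  then show "P \<in> {distr (measure_pmf (mixture a t)) base_space state | a t. \<forall>k. t k \<in> I}"
    using countable_mixture_eq[OF a] P by blast
next
  fix P assume "P \<in> {distr (measure_pmf (mixture a t)) base_space state | a t. \<forall>k. t k \<in> I}"
  then obtain a t where t: "\<And>k. t k \<in> I"
    and P: "P = distr (measure_pmf (mixture a t)) base_space state"
    by auto
  have "distr (measure_pmf (two_point (t k))) base_space state \<in> elementary_priors I Y" for k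
    using t by (auto simp: elementary_priors_eq)
  then show "P \<in> priors I Y"
    unfolding priors_def P countable_mixture_eq[OF refl, symmetric]
    using pmf_nat_sums[of a] pmf_le_1[of a] pmf_nonneg[of a] by blast
qed

text \<open>Whatever triple \<open>law_params\<close> selects, it represents the law of
  \<open>Y\<close> under \<open>R\<close>, so \<open>prior_eqI\<close> recovers \<open>R\<close>
  from that very triple.\<close>

lemma carrier_set_eq:
  assumes "R \<in> elementary_priors I Y"
  obtains x y p where "(x, y, p) \<in> I" "carrier_set I Y R = {state x, state y}"
    "R = distr (measure_pmf (two_point (x, y, p))) base_space state"
proof -
  obtain x y p where t: "law_params I Y R = (x, y, p)"
    using prod_cases3 by blast
  from assms have "\<exists>t. t \<in> I \<and> distr R base_space Y = (case t of (x, y, p) \<Rightarrow> two_point_law x y p)"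
    by (fastforce simp: elementary_priors_def)
  from someI_ex[OF this] have *: "(x, y, p) \<in> I" "distr R base_space Y = two_point_law x y p"
    using t by (auto simp: law_params_def)
  note pos = params_pos[OF *(1)]
  have "{\<omega> \<in> space base_space. Y \<omega> = v} = {state v}" if "0 < v" for v
    using that by (auto simp: space_base_space Y_state state_pos state_Y)
  then have "carrier_set I Y R = {state x, state y}"
    using pos by (auto simp: carrier_set_def t)
  moreover have "R = distr (measure_pmf (two_point (x, y, p))) base_space state"
    using assms * by (intro prior_eqI) (auto simp: elementary_priors_def)
  ultimately show thesis
    using that * by blast
qed

text \<open>The singleton of a charged state is not null for the elementary priors. As
  \<open>Rt\<close> has the same null sets, some \<open>R\<close> in \<open>Rt\<close> charges it
  too, and \<open>R\<close> charges only its own carrier. This keeps the extension from losing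
  mass.\<close>

lemma state_in_carrier:
  assumes t: "t \<in> I" and v: "v \<in> set_pmf (two_point t)"
  obtains R where "R \<in> Rt" "state v \<in> carrier_set I Y R"
proof -
  have B: "{state v} \<in> sets base_space"
    by (simp add: base_space_finite_sets state_pos)
  have null: "emeasure (distr (measure_pmf q) base_space state) {state v} \<noteq> 0 \<longleftrightarrow>
      (\<exists>w\<in>set_pmf q. state w = state v)" for q
    using B by (auto simp: emeasure_distr_state space_base_space measure_pmf.emeasure_eq_measure
        measure_pmf_zero_iff)
  have "distr (measure_pmf (two_point t)) base_space state \<in> elementary_priors I Y"
    using t by (simp add: elementary_priors_eq)
  then obtain R where R: "R \<in> Rt" "R \<in> elementary_priors I Y" "emeasure R {state v} \<noteq> 0"
    using reduction B null v unfolding disjoint_reduction_def by (metis subsetD)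
  obtain x y p where xyp: "(x, y, p) \<in> I" "carrier_set I Y R = {state x, state y}"
    "R = distr (measure_pmf (two_point (x, y, p))) base_space state"
    by (rule carrier_set_eq[OF R(2)])
  have "\<exists>w\<in>{x, y}. state w = state v"
    using R(3) null[of "two_point (x, y, p)"] params_pos[OF xyp(1)]
    unfolding xyp(3) by (simp add: set_two_point)
  then have "state v \<in> carrier_set I Y R"
    unfolding xyp(2) by auto
  with R(1) show thesis
    using that by blast
qed

section \<open>Extension of the priors to the larger sigma-algebra\<close>

abbreviation "G \<equiv> ext_space I Y Rt"

text \<open>The carriers are disjoint, only countably many are charged, and these contain every
  atom. Summing the masses of \<open>A\<close> over them thus yields the whole mass of the atoms in
  \<open>A\<close>.\<close>

lemma ext_measure_eq:
  assumes t: "\<And>k. t k \<in> I"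
  shows "ext_measure I Y Rt (distr (measure_pmf (mixture a t)) base_space state)
    = distr (measure_pmf (mixture a t)) G state"
proof -
  let ?q = "mixture a t"
  let ?P = "distr (measure_pmf ?q) base_space state"
  let ?S = "carrier_set I Y"
  let ?J = "{R\<in>Rt. emeasure ?P (?S R) \<noteq> 0}"
  have S: "finite (?S R)" "?S R \<subseteq> {0<..}" if "R \<in> Rt" for R
  proof -
    have "R \<in> elementary_priors I Y"
      using that reduction by (auto simp: disjoint_reduction_def)
    then show "finite (?S R)" "?S R \<subseteq> {0<..}"
      by (auto elim!: carrier_set_eq simp: state_pos)
  qed
  \<comment> \<open>Subsets of a carrier are finite, hence lie in the base
    \<open>\<sigma>\<close>-algebra, even when they are traces of a set that lies only in the
    extended one.\<close>
  have emP: "emeasure ?P A = emeasure (measure_pmf ?q) (state -` A)" if "R \<in> Rt" "A \<subseteq> ?S R" for A R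
  proof (rule emeasure_distr_state[OF space_base_space])
    show "A \<in> sets base_space"
      using S[OF that(1)] that(2) by (meson base_space_finite_sets finite_subset subset_trans)
  qed
  have J: "?J = {R\<in>Rt. \<exists>v\<in>set_pmf ?q. state v \<in> ?S R}"
    by (auto simp: emP measure_pmf.emeasure_eq_measure measure_pmf_zero_iff disjoint_iff)
  have disj: "disjoint_family_on ?S Rt"
    using reduction by (simp add: disjoint_reduction_def)
  \<comment> \<open>By disjointness an atom determines the carrier containing it, so the charged
    carriers are indexed by the countable support of the law.\<close>
  have "?J \<subseteq> (\<lambda>v. THE R. R \<in> Rt \<and> state v \<in> ?S R) ` set_pmf ?q"
  proof
    fix R assume "R \<in> ?J"
    then obtain v where v: "R \<in> Rt" "v \<in> set_pmf ?q" "state v \<in> ?S R"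
      unfolding J by blast
    then have "(THE R. R \<in> Rt \<and> state v \<in> ?S R) = R"
      using disj by (intro the_equality) (auto simp: disjoint_family_on_def)
    with v show "R \<in> (\<lambda>v. THE R. R \<in> Rt \<and> state v \<in> ?S R) ` set_pmf ?q"
      by force
  qed
  then have countable: "countable ?J"
    by (rule countable_subset) simp
  have covered: "state v \<in> (\<Union>R\<in>?J. ?S R)" if v: "v \<in> set_pmf ?q" for v
  proof -
    obtain k where "v \<in> set_pmf (two_point (t k))"
      using v by (auto simp: mixture_def)
    then obtain R where "R \<in> Rt" "state v \<in> ?S R"
      using t state_in_carrier by metis
    with v show ?thesis
      unfolding J by blast
  qed
  have "(\<integral>\<^sup>+ R. emeasure ?P (A \<inter> ?S R) \<partial>count_space ?J) = emeasure (distr (measure_pmf ?q) G state) A"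
    if A: "A \<in> sets G" for A
  proof -
    have "(\<integral>\<^sup>+ R. emeasure ?P (A \<inter> ?S R) \<partial>count_space ?J)
      = (\<integral>\<^sup>+ R. emeasure (measure_pmf ?q) (state -` (A \<inter> ?S R)) \<partial>count_space ?J)"
      by (intro nn_integral_cong emP) auto
    also have "\<dots> = emeasure (measure_pmf ?q) (\<Union>R\<in>?J. state -` (A \<inter> ?S R))"
      using disj countable
      by (intro emeasure_UN_countable[symmetric]) (auto simp: disjoint_family_on_def)
    also have "\<dots> = emeasure (measure_pmf ?q) (state -` A)"
      using covered by (intro emeasure_eq_AE) (auto simp: AE_measure_pmf_iff)
    also have "\<dots> = emeasure (distr (measure_pmf ?q) G state) A"
      using A by (simp add: emeasure_distr_state space_ext_space)
    finally show ?thesis .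
  qed
  then show ?thesis
    using measure_of_emeasure_eqI[of "distr (measure_pmf ?q) G state" G
        "\<lambda>A. \<integral>\<^sup>+ R. emeasure ?P (A \<inter> ?S R) \<partial>count_space ?J"]
    by (simp add: ext_measure_def space_base_space space_ext_space)
qed

lemma ext_priors_eq:
  "ext_priors I Y Rt = {distr (measure_pmf (mixture a t)) G state | a t. \<forall>k. t k \<in> I}"
proof -
  have "ext_priors I Y Rt
    = {ext_measure I Y Rt (distr (measure_pmf (mixture a t)) base_space state) | a t. \<forall>k. t k \<in> I}"
    unfolding ext_priors_def priors_eq by blast
  also have "\<dots> = {distr (measure_pmf (mixture a t)) G state | a t. \<forall>k. t k \<in> I}"
    using ext_measure_eq by metis
  finally show ?thesis .
qed

end

section \<open>Martingale measures and contiguity\<close>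

text \<open>If the positive or the negative part has infinite integral, the convention gives an
  infinite value. The martingale condition is therefore ordinary integrability with mean
  zero.\<close>

lemma ext_expectation_eq_0_iff:
  assumes f: "f \<in> borel_measurable Q"
  shows "ext_expectation Q f = 0 \<longleftrightarrow> integrable Q f \<and> integral\<^sup>L Q f = 0"
proof -
  let ?a = "\<integral>\<^sup>+ \<omega>. ennreal (f \<omega>) \<partial>Q" and ?b = "\<integral>\<^sup>+ \<omega>. ennreal (- f \<omega>) \<partial>Q"
  have ext: "ext_expectation Q f =
      (if ?a = \<infinity> \<and> ?b = \<infinity> then - \<infinity> else enn2ereal ?a - enn2ereal ?b)"
    by (simp add: ext_expectation_def Let_def ennreal_max_0)
  have int: "integrable Q f \<longleftrightarrow> ?a \<noteq> \<infinity> \<and> ?b \<noteq> \<infinity>"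
    using f by (simp add: real_integrable_def)
  have *: "integral\<^sup>L Q f = enn2real ?a - enn2real ?b" if "integrable Q f"
    using that by (rule real_lebesgue_integral_def)
  show ?thesis
  proof (cases "?a = \<infinity> \<or> ?b = \<infinity>")
    case True
    then show ?thesis
      using int by (cases ?a; cases ?b) (auto simp: ext zero_ereal_def)
  next
    case False
    then show ?thesis
      using int * by (cases ?a; cases ?b) (auto simp: ext zero_ereal_def)
  qed
qed

text \<open>The shifted payoff \<open>H * f \<omega> + c\<close> is nonnegative almost everywhere
  and has mean \<open>c\<close>, so Markov's inequality applies.\<close>

lemma martingale_markov:
  assumes "prob_space Q" and f: "f \<in> borel_measurable Q" and E: "ext_expectation Q f = 0"
    and lower: "AE \<omega> in Q. - c \<le> H * f \<omega>" and "0 < \<alpha>"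
  shows "measure Q {\<omega>\<in>space Q. \<alpha> \<le> H * f \<omega>} \<le> c / \<alpha>"
proof -
  interpret prob_space Q by fact
  have int: "integrable Q f" "integral\<^sup>L Q f = 0"
    using E f by (simp_all add: ext_expectation_eq_0_iff)
  \<comment> \<open>The sign of \<open>c\<close> comes from the mean of the shifted payoff; it
    ensures that the shift only enlarges the event.\<close>
  have c: "0 \<le> c"
  proof -
    have "0 \<le> (\<integral>\<omega>. H * f \<omega> + c \<partial>Q)"
      using lower by (intro integral_nonneg_AE) (auto elim: eventually_mono)
    then show ?thesis
      using int prob_space by simp
  qed
  have "measure Q {\<omega>\<in>space Q. \<alpha> \<le> H * f \<omega>} \<le> measure Q {\<omega>\<in>space Q. \<alpha> \<le> H * f \<omega> + c}"
    using f c by (intro finite_measure_mono) auto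
  also have "\<dots> \<le> (\<integral>\<omega>. H * f \<omega> + c \<partial>Q) / \<alpha>"
    using lower int assms(5)
    by (intro integral_Markov_inequality_measure[where A = "{}"]) (auto elim: eventually_mono)
  also have "\<dots> = c / \<alpha>"
    using int prob_space by simp
  finally show ?thesis .
qed

text \<open>Arbitrage lives on a subsequence while contiguity concerns whole sequences; filling the
  gaps with zeros keeps the limit.\<close>

lemma tendsto_zero_along_subseq:
  fixes c :: "nat \<Rightarrow> real"
  assumes r: "strict_mono r" and c: "c \<longlonglongrightarrow> 0"
  shows "(\<lambda>n. if n \<in> range r then c (inv r n) else 0) \<longlonglongrightarrow> 0"
proof (rule LIMSEQ_I)
  fix e :: real assume "0 < e"
  then obtain K where K: "\<And>k. K \<le> k \<Longrightarrow> norm (c k) < e"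
    using LIMSEQ_D[OF c] by auto
  have "norm (if n \<in> range r then c (inv r n) else 0) < e" if "r K \<le> n" for n
    using that K \<open>0 < e\<close> by (auto simp: strict_mono_less_eq[OF r] inv_f_f[OF strict_mono_imp_inj_on[OF r]])
  then show "\<exists>N. \<forall>n\<ge>N. norm ((if n \<in> range r then c (inv r n) else 0) - 0) < e"
    by (intro exI[of _ "r K"] allI impI) (simp only: diff_zero)
qed

text \<open>The gain events of an arbitrage have probability at least \<open>\<alpha>\<close> under
  its priors, but at most \<open>c k / \<alpha>\<close> under any martingale measure. This
  contradicts contiguity along the subsequence.\<close>

lemma NAA1_if_contiguous:
  assumes meas: "\<And>n. \<Delta> n \<in> borel_measurable (G n)"
    and nonempty: "\<And>n. \<P> n \<noteq> {}"
    and sets_prior: "\<And>n P. P \<in> \<P> n \<Longrightarrow> sets P = sets (G n)"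
    and mart: "\<And>n Q. Q \<in> \<Q> n \<Longrightarrow> prob_space Q \<and> sets Q = sets (G n) \<and>
      (\<exists>P\<in>\<P> n. absolutely_continuous P Q) \<and> ext_expectation Q (\<Delta> n) = 0"
    and contig: "\<And>P. (\<And>n. P n \<in> \<P> n) \<Longrightarrow> \<exists>Q. (\<forall>n. Q n \<in> \<Q> n) \<and> contiguous G P Q"
  shows "NAA1 G \<P> \<Delta>"
  unfolding NAA1_def
proof
  assume "AA1 G \<P> \<Delta>"
  then obtain r H c \<alpha> P where r: "strict_mono r" and c: "c \<longlonglongrightarrow> 0"
    and qs: "\<And>k. quasi_surely (G (r k)) (\<P> (r k)) (\<lambda>\<omega>. H (r k) * \<Delta> (r k) \<omega> \<ge> - c k)"
    and \<alpha>: "0 < \<alpha>" and P: "\<And>k. P k \<in> \<P> (r k)"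
    and P\<alpha>: "\<And>k. measure (P k) {\<omega>\<in>space (G (r k)). H (r k) * \<Delta> (r k) \<omega> \<ge> \<alpha>} \<ge> \<alpha>"
    unfolding AA1_def by blast
  have inv_r: "inv r (r k) = k" for k
    by (rule inv_f_f[OF strict_mono_imp_inj_on[OF r]])
  \<comment> \<open>Off the subsequence any prior will do, because the event \<open>A n\<close>
    below is empty there.\<close>
  define P' where "P' n = (if n \<in> range r then P (inv r n) else (SOME p. p \<in> \<P> n))" for n
  have "P' n \<in> \<P> n" for n
    using P inv_r nonempty[of n] by (auto simp: P'_def some_in_eq)
  then obtain Q where Q: "\<And>n. Q n \<in> \<Q> n" and PQ: "contiguous G P' Q"
    using contig by blast
  define A where "A n = (if n \<in> range r then {\<omega>\<in>space (G n). H n * \<Delta> n \<omega> \<ge> \<alpha>} else {})" for n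
  have A: "A n \<in> sets (G n)" for n
    using meas[of n] by (auto simp: A_def)
  have QA: "measure (Q n) (A n) \<le> (if n \<in> range r then c (inv r n) / \<alpha> else 0)" for n
  proof (cases "n \<in> range r")
    case True
    then obtain k where n: "n = r k" by blast
    obtain R where R: "R \<in> \<P> n" "absolutely_continuous R (Q n)"
      using mart[OF Q] by blast
    have setsQ: "sets (Q n) = sets (G n)" "space (Q n) = space (G n)"
      using mart[OF Q[of n]] sets_eq_imp_space_eq by auto
    obtain N where N: "N \<in> sets (G n)" "emeasure R N = 0"
        "{\<omega>\<in>space (G n). \<not> - c k \<le> H n * \<Delta> n \<omega>} \<subseteq> N"
      using qs[of k] R(1) unfolding quasi_surely_def n by blast
    \<comment> \<open>The quasi-sure lower bound passes to \<open>Q n\<close>, which is dominated by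
      a prior.\<close>
    then have "N \<in> null_sets (Q n)"
      using R sets_prior[OF R(1)] unfolding absolutely_continuous_def
      by (metis null_setsI subsetD)
    then have "AE \<omega> in Q n. - c k \<le> H n * \<Delta> n \<omega>"
      using N(3) setsQ by (intro AE_I') auto
    moreover have "\<Delta> n \<in> borel_measurable (Q n)"
      using meas[of n] by (simp cong: measurable_cong_sets add: setsQ)
    ultimately have "measure (Q n) {\<omega>\<in>space (Q n). \<alpha> \<le> H n * \<Delta> n \<omega>} \<le> c k / \<alpha>"
      using mart[OF Q] \<alpha> by (intro martingale_markov) auto
    then show ?thesis
      by (simp add: A_def n inv_r setsQ[unfolded n])
  qed (simp add: A_def)
  have "(\<lambda>k. c k / \<alpha>) \<longlonglongrightarrow> 0"
    using c by (rule tendsto_divide_zero)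
  from tendsto_zero_along_subseq[OF r this]
  have "(\<lambda>n. if n \<in> range r then c (inv r n) / \<alpha> else 0) \<longlonglongrightarrow> 0" .
  then have "(\<lambda>n. measure (Q n) (A n)) \<longlonglongrightarrow> 0"
    by (rule Lim_null_comparison[rotated]) (simp only: real_norm_def abs_of_nonneg measure_nonneg QA eventually_True)
  then have "(\<lambda>n. measure (P' n) (A n)) \<longlonglongrightarrow> 0"
    using PQ A unfolding contiguous_def by blast
  from LIMSEQ_subseq_LIMSEQ[OF this r]
  have "(\<lambda>k. measure (P k) (A (r k))) \<longlonglongrightarrow> 0"
    by (simp add: o_def P'_def inv_r)
  moreover have "\<alpha> \<le> measure (P k) (A (r k))" for k
    using P\<alpha>[of k] by (simp add: A_def)
  ultimately have "\<alpha> \<le> 0"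
    by (intro LIMSEQ_le_const) auto
  with \<alpha> show False by simp
qed

section \<open>Price events and martingale measures in one market\<close>

context binomial_market
begin

abbreviation "ext_law q \<equiv> distr (measure_pmf q) G state"

lemma Y_measurable_ext: "Y \<in> borel_measurable G"
proof -
  have "Y \<in> borel_measurable base_space"
    using measurable_compose[OF Y_measurable id_measurable_base_space] .
  then have "Y -` A \<inter> space base_space \<in> sets base_space" if "A \<in> sets borel" for A
    using that by (rule measurable_sets)
  then show ?thesis
    by (intro measurableI) (auto simp: space_ext_space space_base_space intro!: sets_base_subset_ext)
qed

lemma set_mixture:
  "set_pmf (mixture a t) = (\<Union>k\<in>set_pmf a. set_pmf (two_point (t k)))"
  by (simp add: mixture_def)

lemma set_mixture_elim:
  assumes "v \<in> set_pmf (mixture a t)" "\<And>k. t k \<in> I"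
  obtains x y p where "(x, y, p) \<in> I" "v = x \<or> v = y"
proof -
  obtain k where "v \<in> set_pmf (two_point (t k))"
    using assms(1) by (auto simp: set_mixture)
  moreover obtain x y p where "t k = (x, y, p)"
    using prod_cases3 by blast
  ultimately show thesis
    using assms(2)[of k] params_pos[of x y p] that[of x y p] by (auto simp: set_two_point)
qed

lemma mixture_in_ext_priors: "(\<And>k. t k \<in> I) \<Longrightarrow> ext_law (mixture a t) \<in> ext_priors I Y Rt"
  by (auto simp: ext_priors_eq)

lemma two_point_in_ext_priors: "t \<in> I \<Longrightarrow> ext_law (two_point t) \<in> ext_priors I Y Rt"
  using mixture_in_ext_priors[of "\<lambda>_. t" "return_pmf 0"] by (simp add: mixture_def bind_return_pmf)

lemma sets_ext_prior: "P \<in> ext_priors I Y Rt \<Longrightarrow> sets P = sets G"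
  by (auto simp: ext_priors_eq)

lemma measure_ext_law:
  "A \<in> sets G \<Longrightarrow> measure (ext_law q) A = measure_pmf.prob q (state -` A)"
  by (simp add: measure_def emeasure_distr_state space_ext_space)

lemma measure_ext_law_price:
  assumes "set_pmf q \<subseteq> {0<..}" "{v. \<phi> v} \<in> sets borel"
  shows "measure (ext_law q) {\<omega>\<in>space G. \<phi> (Y \<omega>)} = measure_pmf.prob q {v. \<phi> v}"
proof -
  have "{\<omega>\<in>space G. \<phi> (Y \<omega>)} = Y -` {v. \<phi> v} \<inter> space G"
    by auto
  then have "{\<omega>\<in>space G. \<phi> (Y \<omega>)} \<in> sets G"
    using measurable_sets[OF Y_measurable_ext assms(2)] by simp
  moreover have "measure_pmf.prob q (state -` {\<omega>\<in>space G. \<phi> (Y \<omega>)}) = measure_pmf.prob q {v. \<phi> v}"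
    using assms(1)
    by (intro measure_pmf.finite_measure_eq_AE)
      (auto simp: AE_measure_pmf_iff Y_state state_pos space_ext_space)
  ultimately show ?thesis
    by (simp add: measure_ext_law)
qed

text \<open>Every prior is carried by the states of up and down values from \<open>I\<close>, where
  \<open>Y\<close> undoes \<open>state\<close>; the exceptional set misses all of these.\<close>

lemma quasi_surely_price:
  assumes \<phi>: "{v. \<phi> v} \<in> sets borel" and all: "\<And>x y p. (x, y, p) \<in> I \<Longrightarrow> \<phi> x \<and> \<phi> y"
  shows "quasi_surely G (ext_priors I Y Rt) (\<lambda>\<omega>. \<phi> (Y \<omega>))"
proof -
  let ?N = "Y -` (- {v. \<phi> v}) \<inter> space G"
  have N: "?N \<in> sets G"
    using \<phi> by (intro measurable_sets[OF Y_measurable_ext]) auto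
  have "emeasure P ?N = 0" if P: "P \<in> ext_priors I Y Rt" for P
  proof -
    obtain a t where t: "\<And>k. t k \<in> I" and P: "P = ext_law (mixture a t)"
      using P by (auto simp: ext_priors_eq)
    have "set_pmf (mixture a t) \<inter> state -` ?N = {}"
    proof (intro equals0I)
      fix v assume v: "v \<in> set_pmf (mixture a t) \<inter> state -` ?N"
      then obtain x y p where xyp: "(x, y, p) \<in> I" "v = x \<or> v = y"
        using t by (auto elim: set_mixture_elim)
      with params_pos[OF xyp(1)] have "Y (state v) = v"
        by (auto simp: Y_state)
      then show False
        using v all[OF xyp(1)] xyp(2) by auto
    qed
    then show ?thesis
      using N by (simp add: P emeasure_distr_state space_ext_space
          measure_pmf.emeasure_eq_measure measure_pmf_zero_iff del: vimage_Int)
  qed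
  with N show ?thesis
    unfolding quasi_surely_def by (intro bexI[of _ ?N]) auto
qed

text \<open>For discrete laws a null set is one that misses the support.\<close>

lemma absolutely_continuous_ext_law:
  "set_pmf q \<subseteq> set_pmf q' \<Longrightarrow> absolutely_continuous (ext_law q') (ext_law q)"
  by (auto simp: absolutely_continuous_def null_sets_def emeasure_distr_state space_ext_space
      measure_pmf.emeasure_eq_measure measure_pmf_zero_iff disjoint_iff) blast

text \<open>Prices are positive, so a nonnegative integral equal to 1 yields both integrability and
  the mean.\<close>

lemma ext_law_martingale_measure:
  assumes ac: "ext_law q' \<in> ext_priors I Y Rt" "set_pmf q \<subseteq> set_pmf q'"
    and pos: "set_pmf q \<subseteq> {0<..}" and mean: "(\<integral>\<^sup>+ v. ennreal v \<partial>measure_pmf q) = 1"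
  shows "ext_law q \<in> martingale_measures I Y Rt"
proof -
  have state: "state \<in> measurable (measure_pmf q) G"
    by (rule state_measurable[OF space_ext_space])
  interpret prob_space "ext_law q"
    using state by (rule measure_pmf.prob_space_distr)
  have Y: "Y \<in> borel_measurable (ext_law q)"
    using Y_measurable_ext by simp
  have Ypos: "AE \<omega> in ext_law q. 0 \<le> Y \<omega>"
    using Y_pos by (intro AE_I2) (force simp: space_ext_space)
  have "(\<integral>\<^sup>+ \<omega>. ennreal (Y \<omega>) \<partial>ext_law q) = (\<integral>\<^sup>+ v. ennreal (Y (state v)) \<partial>measure_pmf q)"
    using Y_measurable_ext state by (subst nn_integral_distr) auto
  also have "\<dots> = (\<integral>\<^sup>+ v. ennreal v \<partial>measure_pmf q)"
    using pos by (intro nn_integral_cong_AE) (auto simp: AE_measure_pmf_iff Y_state)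
  finally have "(\<integral>\<^sup>+ \<omega>. ennreal (Y \<omega>) \<partial>ext_law q) = ennreal 1"
    using mean by simp
  then have "integrable (ext_law q) Y \<and> integral\<^sup>L (ext_law q) Y = 1"
    using nn_integral_eq_integrable[OF Y Ypos, of 1] by simp
  then have "ext_expectation (ext_law q) (\<lambda>\<omega>. Y \<omega> - S0 \<omega>) = 0"
    using Y prob_space by (subst ext_expectation_eq_0_iff) (auto simp: S0_def)
  then show ?thesis
    using ac absolutely_continuous_ext_law prob_space_axioms
    by (auto simp: martingale_measures_def)
qed

text \<open>Only the up value, of probability at most \<open>\<rho>\<close>, is lost when the law is
  replaced by its down value.\<close>

lemma emeasure_two_point_le:
  assumes "(x, y, p) \<in> I" "p \<le> \<rho>"
  shows "emeasure (measure_pmf (two_point (x, y, p))) A \<le> ennreal \<rho> + indicator A y"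
proof -
  note pos = params_pos[OF assms(1)]
  have "ennreal p * indicator A x \<le> ennreal \<rho>" "ennreal (1 - p) * indicator A y \<le> indicator A y"
    using assms pos by (auto simp: indicator_def ennreal_leI)
  then show ?thesis
    using pos by (auto simp: emeasure_two_point intro: add_mono)
qed

text \<open>Below, \<open>b\<close> is the mixture of the down values, and \<open>w\<close> is small enough that a law on
  \<open>{U, d}\<close> taken with weight \<open>1 - w\<close> can bring the mean of the whole to 1.\<close>

lemma ex_dominating_martingale_measure:
  assumes P: "P \<in> ext_priors I Y Rt" and top: "(U, d, p) \<in> I"
    and bounds: "0 < d" "d < 1" "1 < U" "D < U"
    and I: "\<And>x y p. (x, y, p) \<in> I \<Longrightarrow> d \<le> y \<and> y \<le> D \<and> p \<le> \<rho>"
  defines "w \<equiv> (1 - d) * (U - 1) / ((1 + D) * U)"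
  obtains Q where "Q \<in> martingale_measures I Y Rt"
    "\<And>A. A \<in> sets G \<Longrightarrow> measure P A \<le> \<rho> + measure Q A / w"
proof -
  obtain a t where t: "\<And>k. t k \<in> I" and P: "P = ext_law (mixture a t)"
    using P by (auto simp: ext_priors_eq)
  have D: "0 < D" "d \<le> D" and \<rho>: "0 < \<rho>"
    using I[OF top] params_pos[OF top] bounds by auto
  define down where "down k = fst (snd (t k))" for k
  have down: "d \<le> down k" "down k \<le> D" for k
    using I[of "fst (t k)" "down k" "snd (snd (t k))"] t[of k] by (auto simp: down_def)
  define b where "b = map_pmf down a"
  define m where "m = measure_pmf.expectation b (\<lambda>v. v)"
  have b_bounds: "d \<le> v \<and> v \<le> D" if "v \<in> set_pmf b" for v
    using that down by (auto simp: b_def)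
  have int: "integrable (measure_pmf b) (\<lambda>v. v)"
    using b_bounds bounds
    by (intro measure_pmf.integrable_const_bound[where B = D]) (fastforce simp: AE_measure_pmf_iff)+
  have m: "d \<le> m" "m \<le> D"
    unfolding m_def using b_bounds int
    by (auto intro!: measure_pmf.integral_ge_const measure_pmf.integral_le_const simp: AE_measure_pmf_iff)
  have mean_b: "(\<integral>\<^sup>+ v. ennreal v \<partial>measure_pmf b) = ennreal m"
    unfolding m_def using int b_bounds bounds
    by (intro nn_integral_eq_integral) (fastforce simp: AE_measure_pmf_iff)+
  \<comment> \<open>Both factors are at most 1, so each bounds \<open>w\<close>. The first keeps the
    mean required of the other component above \<open>d\<close>, the second keeps it below
    \<open>U\<close>.\<close>
  have w_eq: "w = (1 - d) / (1 + D) * ((U - 1) / U)"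
    by (simp add: w_def)
  have "w \<le> (1 - d) / (1 + D)"
    unfolding w_eq using bounds D by (intro mult_left_le) auto
  then have l1: "w * (1 + D) \<le> 1 - d"
    using D by (simp add: field_simps)
  have "w \<le> (U - 1) / U"
    unfolding w_eq using bounds D by (intro mult_left_le_one_le) auto
  then have l2: "w * U \<le> U - 1"
    using bounds by (simp add: field_simps)
  have l: "0 < w"
    unfolding w_eq using bounds D by simp
  have l_lt_1: "w < 1"
  proof (rule ccontr)
    assume "\<not> w < 1"
    then have "1 * U \<le> w * U"
      using bounds by (intro mult_right_mono) auto
    then show False
      using l2 by simp
  qed
  \<comment> \<open>The component of weight \<open>1 - w\<close> must have mean
    \<open>(1 - w * m) / (1 - w)\<close>; this is the probability of \<open>U\<close> that achieves
    it on the values \<open>U\<close> and \<open>d\<close>.\<close>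
  define \<theta> where "\<theta> = ((1 - w * m) / (1 - w) - d) / (U - d)"
  have "w * (m - d) \<le> w * (1 + D)" "w * (U - m) \<le> w * U"
    using l m bounds by (auto intro!: mult_left_mono)
  then have "d * (1 - w) \<le> 1 - w * m" "1 - w * m \<le> U * (1 - w)"
    using l1 l2 by (auto simp: algebra_simps)
  then have "d \<le> (1 - w * m) / (1 - w)" "(1 - w * m) / (1 - w) \<le> U"
    using l_lt_1 by (auto simp: field_simps)
  then have \<theta>: "0 \<le> \<theta>" "\<theta> \<le> 1"
    using bounds by (auto simp: \<theta>_def field_simps)
  have "\<theta> * (U - d) = (1 - w * m) / (1 - w) - d"
    using bounds by (simp add: \<theta>_def)
  then have "(1 - w) * (\<theta> * U + (1 - \<theta>) * d) = (1 - w) * ((1 - w * m) / (1 - w))"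
    by (simp add: algebra_simps)
  also have "\<dots> = 1 - w * m"
    using l_lt_1 by simp
  finally have mean: "m * w + (U * \<theta> + d * (1 - \<theta>)) * (1 - w) = 1"
    by (simp add: algebra_simps)
  define q where "q = bind_pmf (bernoulli_pmf w) (\<lambda>c. if c then b else two_point (U, d, \<theta>))"
  have q_set: "set_pmf q \<subseteq> set_pmf b \<union> {U, d}"
    by (auto simp: q_def two_point_def split: if_splits)
  have q_mean: "(\<integral>\<^sup>+ v. ennreal v \<partial>measure_pmf q) = 1"
  proof -
    have "(\<integral>\<^sup>+ v. ennreal v \<partial>measure_pmf (two_point (U, d, \<theta>))) = ennreal (U * \<theta> + d * (1 - \<theta>))"
      using \<theta> bounds by (simp add: two_point_def ennreal_mult ennreal_plus)
    then have "(\<integral>\<^sup>+ v. ennreal v \<partial>measure_pmf q)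
      = ennreal (m * w + (U * \<theta> + d * (1 - \<theta>)) * (1 - w))"
      using l l_lt_1 m \<theta> bounds by (simp add: q_def mean_b ennreal_mult ennreal_plus)
    then show ?thesis
      by (simp add: mean)
  qed
  \<comment> \<open>A prior dominating \<open>q\<close>: index 0 carries the triple
    \<open>(U, d, p)\<close>, and index \<open>k + 1\<close> carries \<open>t k\<close>. Its support
    contains \<open>U\<close>, \<open>d\<close> and all charged down values. The weight
    \<open>\<theta>\<close> need not be admissible, so \<open>p\<close> is used instead.\<close>
  define q' where "q' = mixture (bind_pmf (bernoulli_pmf (1/2))
    (\<lambda>c. if c then map_pmf Suc a else return_pmf 0)) (case_nat (U, d, p) t)"
  have "case_nat (U, d, p) t k \<in> I" for k
    using top t by (cases k) auto
  then have q'_prior: "ext_law q' \<in> ext_priors I Y Rt"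
    unfolding q'_def by (rule mixture_in_ext_priors)
  have "{U, d} \<subseteq> set_pmf q'"
    using params_pos[OF top] by (auto simp: q'_def set_mixture set_two_point)
  moreover have "set_pmf b \<subseteq> set_pmf q'"
  proof
    fix v assume "v \<in> set_pmf b"
    then obtain k where k: "k \<in> set_pmf a" "v = down k"
      by (auto simp: b_def)
    obtain x y r where xyr: "t k = (x, y, r)"
      using prod_cases3 by blast
    then have "v \<in> set_pmf (two_point (t k))"
      using k t[of k] params_pos[of x y r] by (simp add: down_def set_two_point)
    moreover have "Suc k \<in> set_pmf (bind_pmf (bernoulli_pmf (1/2))
        (\<lambda>c. if c then map_pmf Suc a else return_pmf 0))"
      using k(1) by auto
    ultimately show "v \<in> set_pmf q'"
      unfolding q'_def set_mixture by (intro UN_I[of "Suc k"]) simp_all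
  qed
  ultimately have "set_pmf q \<subseteq> set_pmf q'"
    using q_set by auto
  moreover have "set_pmf q \<subseteq> {0<..}"
    using q_set b_bounds bounds by force
  ultimately have "ext_law q \<in> martingale_measures I Y Rt"
    using q'_prior q_mean by (intro ext_law_martingale_measure)
  moreover have "measure P A \<le> \<rho> + measure (ext_law q) A / w" if A: "A \<in> sets G" for A
  proof -
    let ?S = "state -` A"
    \<comment> \<open>Averaging this bound over the random index compares the mixture with
      \<open>b\<close>.\<close>
    have "emeasure (measure_pmf (two_point (t k))) ?S \<le> ennreal \<rho> + indicator ?S (down k)" for k
      using emeasure_two_point_le[of "fst (t k)" "down k" "snd (snd (t k))" \<rho> ?S]
        I[of "fst (t k)" "down k" "snd (snd (t k))"] t[of k] by (simp add: down_def)
    then have "emeasure (measure_pmf (mixture a t)) ?S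
      \<le> (\<integral>\<^sup>+ k. ennreal \<rho> + indicator ?S (down k) \<partial>measure_pmf a)"
      unfolding mixture_def emeasure_bind_pmf by (intro nn_integral_mono) auto
    also have "\<dots> = ennreal \<rho> + (\<integral>\<^sup>+ k. indicator ?S (down k) \<partial>measure_pmf a)"
      by (subst nn_integral_add) auto
    also have "(\<integral>\<^sup>+ k. indicator ?S (down k) \<partial>measure_pmf a) = emeasure (measure_pmf b) ?S"
      unfolding b_def by (subst nn_integral_indicator[symmetric]) (simp_all add: nn_integral_map_pmf)
    finally have "measure_pmf.prob (mixture a t) ?S \<le> \<rho> + measure_pmf.prob b ?S"
      using \<rho> by (simp add: measure_pmf.emeasure_eq_measure flip: ennreal_plus)
    \<comment> \<open>As \<open>b\<close> enters \<open>q\<close> with weight \<open>w\<close>, its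
      probabilities are at most those of \<open>q\<close> divided by \<open>w\<close>.\<close>
    moreover have "measure_pmf.prob q ?S = measure_pmf.prob b ?S * w
        + measure_pmf.prob (two_point (U, d, \<theta>)) ?S * (1 - w)"
    proof -
      have "emeasure (measure_pmf q) ?S = emeasure (measure_pmf b) ?S * w
        + emeasure (measure_pmf (two_point (U, d, \<theta>))) ?S * (1 - w)"
        using l l_lt_1 by (simp add: q_def)
      then show ?thesis
        using l l_lt_1
        by (simp add: measure_pmf.emeasure_eq_measure flip: ennreal_plus ennreal_mult)
    qed
    then have "measure_pmf.prob b ?S * w \<le> measure_pmf.prob q ?S"
      using l_lt_1 by simp
    then have "measure_pmf.prob b ?S \<le> measure_pmf.prob q ?S / w"
      using l by (simp add: field_simps)
    ultimately show ?thesis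
      using A by (simp add: P measure_ext_law)
  qed
  ultimately show thesis
    using that by blast
qed

end

section \<open>Asymptotic arbitrage\<close>

lemma limsup_eq_0_iff_tendsto:
  fixes f :: "nat \<Rightarrow> real"
  assumes "\<And>n. 0 \<le> f n"
  shows "limsup (\<lambda>n. ereal (f n)) = 0 \<longleftrightarrow> f \<longlonglongrightarrow> 0"
proof
  assume sup: "limsup (\<lambda>n. ereal (f n)) = 0"
  have "0 \<le> liminf (\<lambda>n. ereal (f n))"
    using assms by (intro Liminf_bounded) simp
  moreover have "liminf (\<lambda>n. ereal (f n)) \<le> 0"
    using Liminf_le_Limsup[of sequentially "\<lambda>n. ereal (f n)"] sup by simp
  ultimately have "(\<lambda>n. ereal (f n)) \<longlonglongrightarrow> ereal 0"
    using sup by (subst tendsto_iff_Liminf_eq_Limsup) (auto simp: zero_ereal_def)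
  then show "f \<longlonglongrightarrow> 0"
    by simp
next
  assume "f \<longlonglongrightarrow> 0"
  then have "(\<lambda>n. ereal (f n)) \<longlonglongrightarrow> ereal 0"
    by simp
  from lim_imp_Limsup[OF sequentially_bot this]
  show "limsup (\<lambda>n. ereal (f n)) = 0"
    by (simp add: zero_ereal_def)
qed

lemma prob_two_point:
  assumes "0 \<le> p" "p \<le> 1"
  shows "measure_pmf.prob (two_point (x, y, p)) A = p * indicator A x + (1 - p) * indicator A y"
proof -
  have "ennreal (measure_pmf.prob (two_point (x, y, p)) A) = ennreal (p * indicator A x + (1 - p) * indicator A y)"
    using assms emeasure_two_point[OF assms, of x y A]
    by (auto simp: measure_pmf.emeasure_eq_measure indicator_def simp flip: ennreal_plus)
  then show ?thesis
    using assms by (subst (asm) ennreal_inj) (auto simp: indicator_def)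
qed

lemma inverse_sqrt_tendsto_0:
  fixes f :: "nat \<Rightarrow> real"
  assumes "(\<lambda>n. ereal (f n)) \<longlonglongrightarrow> \<infinity>"
  shows "(\<lambda>n. inverse (sqrt (f n))) \<longlonglongrightarrow> 0"
proof -
  have "filterlim f at_top sequentially"
    using assms unfolding filterlim_at_top_dense tendsto_PInfty by simp
  then show ?thesis
    by (intro tendsto_inverse_0_at_top filterlim_compose[OF sqrt_at_top])
qed

text \<open>A position of \<open>1 / sqrt a\<close> shares costs little for large \<open>a\<close>
  but still gains 1 at prices from \<open>a\<close> on. The threshold 4 gives
  \<open>2 \<le> sqrt a\<close>, hence \<open>sqrt a \<le> a / 2 \<le> a - 1\<close>.\<close>

lemma inverse_sqrt_mult_ge_1:
  fixes a v :: real
  assumes "4 \<le> a" "a \<le> v"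
  shows "1 \<le> inverse (sqrt a) * (v - 1)"
proof -
  have "2 \<le> sqrt a"
    using assms by (intro real_le_rsqrt) simp
  moreover have "2 * sqrt a \<le> sqrt a * sqrt a"
    using \<open>2 \<le> sqrt a\<close> assms by (intro mult_right_mono) auto
  moreover have "sqrt a * sqrt a = a"
    using assms by simp
  ultimately have "sqrt a \<le> v - 1"
    using assms by linarith
  then show ?thesis
    using assms by (simp add: field_simps)
qed

text \<open>A long position loses at most \<open>H n * (1 - l n)\<close> when all prices are at
  least \<open>l n\<close>. An arbitrage is then specified by position sizes, lower bounds and one
  triple per market; \<open>l n < 1\<close> makes the loss bounds strictly positive.\<close>

lemma AA1_markets:
  fixes r :: "nat \<Rightarrow> nat" and H l :: "nat \<Rightarrow> real"
  assumes market: "\<And>n. binomial_market (I n) (Y n) (Rt n)"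
    and r: "strict_mono r" and H: "\<And>n. 0 < H n" and l: "\<And>n. l n < 1"
    and lower: "\<And>n x y p. (x, y, p) \<in> I n \<Longrightarrow> l n \<le> x \<and> l n \<le> y"
    and cost: "(\<lambda>n. H n * (1 - l n)) \<longlonglongrightarrow> 0"
    and t: "\<And>k. t k \<in> I (r k)" and \<alpha>: "0 < \<alpha>"
    and gain: "\<And>k. \<alpha> \<le> measure_pmf.prob (two_point (t k)) {v. \<alpha> \<le> H (r k) * (v - 1)}"
  shows "AA1 (\<lambda>n. ext_space (I n) (Y n) (Rt n)) (\<lambda>n. ext_priors (I n) (Y n) (Rt n))
    (\<lambda>n \<omega>. Y n \<omega> - S0 \<omega>)"
proof -
  let ?c = "\<lambda>k. H (r k) * (1 - l (r k))"
  let ?P = "\<lambda>k. distr (measure_pmf (two_point (t k))) (ext_space (I (r k)) (Y (r k)) (Rt (r k)))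
    (binomial_market.state (Y (r k)))"
  have c_pos: "0 < ?c k" for k
    using H l by simp
  have c_lim: "?c \<longlonglongrightarrow> 0"
    using LIMSEQ_subseq_LIMSEQ[OF cost r] by (simp add: o_def)
  have borel: "{v. a \<le> H n * (v - 1)} \<in> sets borel" for a n
    by measurable
  have qs: "quasi_surely (ext_space (I (r k)) (Y (r k)) (Rt (r k)))
      (ext_priors (I (r k)) (Y (r k)) (Rt (r k))) (\<lambda>\<omega>. H (r k) * (Y (r k) \<omega> - S0 \<omega>) \<ge> - ?c k)"
    and prior: "?P k \<in> ext_priors (I (r k)) (Y (r k)) (Rt (r k))"
    and gain_prior: "\<alpha> \<le> measure (?P k) {\<omega> \<in> space (ext_space (I (r k)) (Y (r k)) (Rt (r k))).
      \<alpha> \<le> H (r k) * (Y (r k) \<omega> - S0 \<omega>)}" for k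
  proof -
    interpret binomial_market "I (r k)" "Y (r k)" "Rt (r k)"
      by (rule market)
    have "- ?c k \<le> H (r k) * (v - 1)" if "l (r k) \<le> v" for v
    proof -
      have "H (r k) * (l (r k) - 1) \<le> H (r k) * (v - 1)"
        using that H[of "r k"] by (intro mult_left_mono) auto
      then show ?thesis
        by (simp add: algebra_simps)
    qed
    then show "quasi_surely (ext_space (I (r k)) (Y (r k)) (Rt (r k)))
        (ext_priors (I (r k)) (Y (r k)) (Rt (r k))) (\<lambda>\<omega>. H (r k) * (Y (r k) \<omega> - S0 \<omega>) \<ge> - ?c k)"
      using lower[of _ _ _ "r k"] borel unfolding S0_def
      by (intro quasi_surely_price[where \<phi> = "\<lambda>v. H (r k) * (v - 1) \<ge> - ?c k"]) blast+
    show "?P k \<in> ext_priors (I (r k)) (Y (r k)) (Rt (r k))"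
      by (rule two_point_in_ext_priors[OF t])
    obtain x y p where xyp: "t k = (x, y, p)"
      using prod_cases3 by blast
    then have "set_pmf (two_point (t k)) \<subseteq> {0<..}"
      using params_pos[of x y p] t[of k] by (auto simp: set_two_point)
    then show "\<alpha> \<le> measure (?P k) {\<omega> \<in> space (ext_space (I (r k)) (Y (r k)) (Rt (r k))).
        \<alpha> \<le> H (r k) * (Y (r k) \<omega> - S0 \<omega>)}"
      using gain[of k] measure_ext_law_price[OF _ borel, of "two_point (t k)" \<alpha> "r k"]
      by (simp add: S0_def)
  qed
  show ?thesis
    unfolding AA1_def
    by (rule exI[of _ r], rule exI[of _ H], rule exI[of _ ?c],
        intro conjI exI[of _ \<alpha>] exI[of _ ?P] allI)
      (fact r c_pos c_lim qs \<alpha> prior gain_prior)+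
qed

section \<open>The equivalence in the case of infinite \<open>U\<close>\<close>

theorem theorem5p9:
  fixes u U d D \<pi>l \<pi>u :: "nat \<Rightarrow> real"
    and ulim Ulim dlim Dlim :: ereal
    and I :: "nat \<Rightarrow> (real \<times> real \<times> real) set"
    and Y :: "nat \<Rightarrow> real \<Rightarrow> real"
    and Rt :: "nat \<Rightarrow> real measure set"
  assumes A1: "\<And>n. 0 < \<pi>l n \<and> \<pi>l n \<le> \<pi>u n \<and> \<pi>u n < 1"
      "\<And>n. d n \<le> D n \<and> u n \<le> U n"
      "\<And>n. 0 < d n \<and> d n < 1 \<and> 1 < U n"
    and A2: "\<And>n. d n < min (u n) (D n) \<and> max (u n) (D n) < U n"
    and A3: "dlim \<in> {0..1}" "Dlim \<in> {0..\<infinity>}" "ulim \<in> {0..\<infinity>}" "Ulim \<in> {1..\<infinity>}"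
      "(\<lambda>n. ereal (d n)) \<longlonglongrightarrow> dlim" "(\<lambda>n. ereal (D n)) \<longlonglongrightarrow> Dlim"
      "(\<lambda>n. ereal (u n)) \<longlonglongrightarrow> ulim" "(\<lambda>n. ereal (U n)) \<longlonglongrightarrow> Ulim"
    and A4: "dlim < Ulim"
      "{dlim..Dlim} \<noteq> {1} \<or> limsup (\<lambda>n. ereal (\<pi>u n)) > 0"
      "{ulim..Ulim} \<noteq> {1} \<or> liminf (\<lambda>n. ereal (\<pi>l n)) < 1"
    and I: "\<And>n. I n = {u n..U n} \<times> {d n..D n} \<times> {\<pi>l n..\<pi>u n}"
    and Y: "\<And>n. Y n \<in> measurable base_space base_space"
      "\<And>n. bij_betw (Y n) {0<..} {0<..}"
    and Rt: "\<And>n. disjoint_reduction (I n) (Y n) (Rt n)"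
    and U_infinite: "Ulim = \<infinity>"
  shows "(NAA1 (\<lambda>n. ext_space (I n) (Y n) (Rt n)) (\<lambda>n. ext_priors (I n) (Y n) (Rt n))
            (\<lambda>n \<omega>. Y n \<omega> - S0 \<omega>)
          \<longleftrightarrow> limsup (\<lambda>n. ereal (\<pi>u n)) = 0 \<and> dlim < 1 \<and> Dlim < \<infinity>) \<and>
         (limsup (\<lambda>n. ereal (\<pi>u n)) = 0 \<and> dlim < 1 \<and> Dlim < \<infinity>
          \<longleftrightarrow> (\<forall>P. (\<forall>n. P n \<in> ext_priors (I n) (Y n) (Rt n)) \<longrightarrow>
                (\<exists>Q. (\<forall>n. Q n \<in> martingale_measures (I n) (Y n) (Rt n)) \<and>
                     contiguous (\<lambda>n. ext_space (I n) (Y n) (Rt n)) P Q)))"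
proof -
  let ?AA1 = "AA1 (\<lambda>n. ext_space (I n) (Y n) (Rt n)) (\<lambda>n. ext_priors (I n) (Y n) (Rt n))
    (\<lambda>n \<omega>. Y n \<omega> - S0 \<omega>)"
  let ?contig = "\<forall>P. (\<forall>n. P n \<in> ext_priors (I n) (Y n) (Rt n)) \<longrightarrow>
    (\<exists>Q. (\<forall>n. Q n \<in> martingale_measures (I n) (Y n) (Rt n)) \<and>
      contiguous (\<lambda>n. ext_space (I n) (Y n) (Rt n)) P Q)"
  have params: "0 < x \<and> 0 < y \<and> d n \<le> x \<and> d n \<le> y \<and> y \<le> D n \<and> 0 < p \<and> p < 1 \<and> p \<le> \<pi>u n"
    if "(x, y, p) \<in> I n" for x y p n
    using that A1(1,3)[of n] A2[of n] by (auto simp: I)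
  have market: "binomial_market (I n) (Y n) (Rt n)" for n
    by unfold_locales (use params Y Rt in auto)
  have limsup: "limsup (\<lambda>n. ereal (\<pi>u n)) = 0 \<longleftrightarrow> \<pi>u \<longlonglongrightarrow> 0"
    using A1(1) by (intro limsup_eq_0_iff_tendsto) (meson less_le_trans less_imp_le)
  have U_lim: "(\<lambda>n. ereal (U n)) \<longlonglongrightarrow> \<infinity>"
    using A3(8) U_infinite by simp
  have top: "(U n, D n, \<pi>u n) \<in> I n" "(U n, d n, \<pi>u n) \<in> I n" and D_pos: "0 < D n" for n
    using A1[of n] by (auto simp: I)
  have U_gain: "\<pi>u n \<le> measure_pmf.prob (two_point (U n, D n, \<pi>u n)) A" if "U n \<in> A" for n A
    using that A1(1)[of n] by (subst prob_two_point) (auto simp: indicator_def)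
  have UD_gain: "measure_pmf.prob (two_point (U n, D n, \<pi>u n)) A = 1" if "U n \<in> A" "D n \<in> A" for n A
    using that A1(1)[of n] by (subst prob_two_point) (auto simp: indicator_def)
  have 1: ?AA1 if not_lim: "\<not> \<pi>u \<longlonglongrightarrow> 0"
  proof -
    \<comment> \<open>The up probabilities are nonnegative, so failing to vanish means exceeding
      some \<open>e\<close> infinitely often; \<open>U n\<close> is eventually at least 4, which
      allows a common subsequence.\<close>
    obtain e where e: "0 < e" "\<exists>\<^sub>F n in sequentially. e \<le> \<pi>u n"
    proof -
      from not_lim obtain e where "0 < e" "\<not> (\<forall>\<^sub>F n in sequentially. dist (\<pi>u n) 0 < e)"
        unfolding tendsto_iff by blast
      moreover have "\<bar>\<pi>u n\<bar> = \<pi>u n" for n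
        using A1(1)[of n] by simp
      ultimately show thesis
        using that[of e] by (simp add: frequently_def not_le)
    qed
    moreover have "\<forall>\<^sub>F n in sequentially. 4 \<le> U n"
      using U_lim[unfolded tendsto_PInfty, rule_format, of 4] by (auto elim: eventually_mono)
    ultimately have "\<exists>\<^sub>F n in sequentially. e \<le> \<pi>u n \<and> 4 \<le> U n"
      by (auto intro: frequently_eventually_frequently)
    then have "infinite {n. e \<le> \<pi>u n \<and> 4 \<le> U n}"
      by (simp add: frequently_cofinite flip: cofinite_eq_sequentially)
    from infinite_enumerate[OF this]
    obtain r :: "nat \<Rightarrow> nat" where r: "strict_mono r" "\<And>k. e \<le> \<pi>u (r k) \<and> 4 \<le> U (r k)"
      by auto
    \<comment> \<open>The up move gains at least 1 with probability at least \<open>e\<close>. Since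
      \<open>\<alpha>\<close> bounds both gain and probability, the minimum is taken.\<close>
    show ?AA1
    proof (rule AA1_markets[where H = "\<lambda>n. inverse (sqrt (U n))" and l = "\<lambda>_. 0"
          and t = "\<lambda>k. (U (r k), D (r k), \<pi>u (r k))" and \<alpha> = "min e 1", OF market r(1)])
      show "min e 1 \<le> measure_pmf.prob (two_point (U (r k), D (r k), \<pi>u (r k)))
          {v. min e 1 \<le> inverse (sqrt (U (r k))) * (v - 1)}" for k
        using r(2)[of k] inverse_sqrt_mult_ge_1[of "U (r k)" "U (r k)"]
        by (intro order_trans[OF _ U_gain]) auto
      show "0 < inverse (sqrt (U n))" for n
        using A1(3)[of n] by simp
    qed (use e params inverse_sqrt_tendsto_0[OF U_lim] top in \<open>auto intro: less_imp_le\<close>)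
  qed
  have 2: ?AA1 if lim: "\<pi>u \<longlonglongrightarrow> 0" and d1: "\<not> dlim < 1"
  proof -
    have dlim: "dlim = 1"
      using d1 A3(1) by auto
    have "dlim \<le> Dlim"
      using A3(5,6) A1(2) by (intro LIMSEQ_le[OF A3(5,6)]) auto
    \<comment> \<open>By (A4), since the up probabilities vanish here, the limit interval of down
      values is not reduced to 1.\<close>
    moreover have "Dlim \<noteq> 1"
      using A4(2) limsup lim dlim by auto
    ultimately obtain z where z: "1 < ereal z" "ereal z < Dlim"
      using ereal_dense2[of 1 Dlim] dlim by force
    obtain N where N: "\<And>n. N \<le> n \<Longrightarrow> z < D n"
      using order_tendstoD(1)[OF A3(6) z(2)] by (auto simp: eventually_sequentially)
    have d_lim: "d \<longlonglongrightarrow> 1"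
      using A3(5) by (simp add: dlim one_ereal_def)
    \<comment> \<open>One share loses at most \<open>1 - d n\<close>, which vanishes, and at the
      largest down value even the down move gains at least \<open>z - 1\<close>.\<close>
    show ?AA1
    proof (rule AA1_markets[where H = "\<lambda>_. 1" and l = d and r = "\<lambda>k. k + N"
          and t = "\<lambda>k. (U (k + N), D (k + N), \<pi>u (k + N))" and \<alpha> = "min (z - 1) 1", OF market])
      show "min (z - 1) 1 \<le> measure_pmf.prob (two_point (U (k + N), D (k + N), \<pi>u (k + N)))
          {v. min (z - 1) 1 \<le> 1 * (v - 1)}" for k
        using N[of "k + N"] A2[of "k + N"] by (subst UD_gain) auto
      show "(\<lambda>n. 1 * (1 - d n)) \<longlonglongrightarrow> 0"
        using tendsto_diff[OF tendsto_const d_lim, of 1] by simp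
      show "0 < min (z - 1) 1"
        using z(1) by simp
    qed (use A1 params top in \<open>auto simp: strict_mono_def\<close>)
  qed
  have 3: ?AA1 if D: "\<not> Dlim < \<infinity>"
  proof -
    have D_lim: "(\<lambda>n. ereal (D n)) \<longlonglongrightarrow> \<infinity>"
      using A3(6) D by simp
    obtain N where N: "\<And>n. N \<le> n \<Longrightarrow> 4 < D n"
      using D_lim[unfolded tendsto_PInfty, rule_format, of 4] by (auto simp: eventually_sequentially)
    \<comment> \<open>With the largest down value, both moves gain at least 1 from index
      \<open>N\<close> on, so the gain has probability 1 whatever the up probability is.\<close>
    show ?AA1
    proof (rule AA1_markets[where H = "\<lambda>n. inverse (sqrt (D n))" and l = "\<lambda>_. 0" and r = "\<lambda>k. k + N"
          and t = "\<lambda>k. (U (k + N), D (k + N), \<pi>u (k + N))" and \<alpha> = 1, OF market])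
      show "1 \<le> measure_pmf.prob (two_point (U (k + N), D (k + N), \<pi>u (k + N)))
          {v. 1 \<le> inverse (sqrt (D (k + N))) * (v - 1)}" for k
        using N[of "k + N"] A2[of "k + N"]
          inverse_sqrt_mult_ge_1[of "D (k + N)" "D (k + N)"]
          inverse_sqrt_mult_ge_1[of "D (k + N)" "U (k + N)"]
        by (subst UD_gain) auto
    qed (use D_pos params inverse_sqrt_tendsto_0[OF D_lim] top in \<open>auto simp: strict_mono_def intro: less_imp_le\<close>)
  qed
  have 4: ?contig if lim: "\<pi>u \<longlonglongrightarrow> 0" and "dlim < 1" "Dlim < \<infinity>"
  proof (intro allI impI)
    obtain d0 where d0: "dlim = ereal d0" "d0 < 1"
      using \<open>dlim < 1\<close> A3(1) by (cases dlim) auto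
    obtain D0 where D0: "Dlim = ereal D0" "0 \<le> D0"
      using \<open>Dlim < \<infinity>\<close> A3(2) by (cases Dlim) auto
    define w where "w n = (1 - d n) * (U n - 1) / ((1 + D n) * U n)" for n
    have U_inv: "(\<lambda>n. inverse (U n)) \<longlonglongrightarrow> 0"
      using U_lim by (intro tendsto_inverse_0_at_top) (simp add: filterlim_at_top_dense tendsto_PInfty)
    \<comment> \<open>This form shows that \<open>w\<close> has a positive limit, so dividing by it
      preserves convergence to 0.\<close>
    have "w = (\<lambda>n. (1 - d n) / (1 + D n) * (1 - inverse (U n)))"
    proof
      show "w n = (1 - d n) / (1 + D n) * (1 - inverse (U n))" for n
        using A1(3)[of n] by (simp add: w_def field_simps)
    qed
    moreover have "(\<lambda>n. (1 - d n) / (1 + D n) * (1 - inverse (U n))) \<longlonglongrightarrow> (1 - d0) / (1 + D0) * (1 - 0)"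
      using A3(5,6) d0 D0 U_inv by (intro tendsto_intros) auto
    ultimately have w_lim: "w \<longlonglongrightarrow> (1 - d0) / (1 + D0)"
      by simp
    fix P assume P: "\<forall>n. P n \<in> ext_priors (I n) (Y n) (Rt n)"
    have "\<exists>Q. Q \<in> martingale_measures (I n) (Y n) (Rt n) \<and>
        (\<forall>A\<in>sets (ext_space (I n) (Y n) (Rt n)). measure (P n) A \<le> \<pi>u n + measure Q A / w n)" for n
      using binomial_market.ex_dominating_martingale_measure[OF market P[rule_format] top(2), of n "D n" "\<pi>u n"]
        A1(3)[of n] A2[of n] params[of _ _ _ n] unfolding w_def by (metis max_less_iff_conj)
    then obtain Q where Q: "\<And>n. Q n \<in> martingale_measures (I n) (Y n) (Rt n)"
      and PQ: "\<And>n A. A \<in> sets (ext_space (I n) (Y n) (Rt n)) \<Longrightarrow>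
        measure (P n) A \<le> \<pi>u n + measure (Q n) A / w n"
      by metis
    have "contiguous (\<lambda>n. ext_space (I n) (Y n) (Rt n)) P Q"
      unfolding contiguous_def
    proof (intro allI impI)
      fix A assume A: "\<forall>n. A n \<in> sets (ext_space (I n) (Y n) (Rt n))"
        and QA: "(\<lambda>n. measure (Q n) (A n)) \<longlonglongrightarrow> 0"
      have "(\<lambda>n. \<pi>u n + measure (Q n) (A n) / w n) \<longlonglongrightarrow> 0 + 0 / ((1 - d0) / (1 + D0))"
        using d0 D0 by (intro tendsto_add lim tendsto_divide QA w_lim) auto
      then have "(\<lambda>n. \<pi>u n + measure (Q n) (A n) / w n) \<longlonglongrightarrow> 0"
        by simp
      then show "(\<lambda>n. measure (P n) (A n)) \<longlonglongrightarrow> 0"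
        by (rule Lim_null_comparison[rotated])
          (simp only: real_norm_def abs_of_nonneg measure_nonneg PQ A eventually_True)
    qed
    with Q show "\<exists>Q. (\<forall>n. Q n \<in> martingale_measures (I n) (Y n) (Rt n)) \<and>
        contiguous (\<lambda>n. ext_space (I n) (Y n) (Rt n)) P Q"
      by blast
  qed
  have 5: "\<not> ?AA1" if ?contig
    unfolding NAA1_def[symmetric]
  proof (rule NAA1_if_contiguous[where \<Q> = "\<lambda>n. martingale_measures (I n) (Y n) (Rt n)"])
    show "(\<lambda>\<omega>. Y n \<omega> - S0 \<omega>) \<in> borel_measurable (ext_space (I n) (Y n) (Rt n))" for n
      using binomial_market.Y_measurable_ext[OF market] by (simp add: S0_def[abs_def])
    show "ext_priors (I n) (Y n) (Rt n) \<noteq> {}" for n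
      using binomial_market.two_point_in_ext_priors[OF market top(1)] by blast
    show "sets P = sets (ext_space (I n) (Y n) (Rt n))" if "P \<in> ext_priors (I n) (Y n) (Rt n)" for n P
      using binomial_market.sets_ext_prior[OF market that] .
  qed (use that in \<open>auto simp: martingale_measures_def\<close>)
  \<comment> \<open>Facts 1 to 3 give (i) to (ii) by contraposition, fact 4 gives (ii) to (iii), and
    fact 5 closes the cycle.\<close>
  show ?thesis
    unfolding NAA1_def limsup using 1 2 3 4 5 by blast
qed

end
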